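(* Let $(\mathfrak A,\mathfrak A_0)$ and $(\mathfrak B,\mathfrak B_0)$ be quasi *-algebras. Regard the algebraic tensor product *-algebra $\mathfrak A_0\otimes\mathfrak B_0$ as a linear subspace of the vector space tensor product $\mathfrak A\otimes\mathfrak B$. Then there are well-defined bilinear maps $(\mathfrak A\otimes\mathfrak B)\times(\mathfrak A_0\otimes\mathfrak B_0)\to\mathfrak A\otimes\mathfrak B$ and $(\mathfrak A_0\otimes\mathfrak B_0)\times(\mathfrak A\otimes\mathfrak B)\to\mathfrak A\otimes\mathfrak B$ with $$(a\otimes b)(x\otimes y)=(ax)\otimes(by),\qquad (x\otimes y)(a\otimes b)=(xa)\otimes(yb)$$ for all $a\in\mathfrak A$, $b\in\mathfrak B$, $x\in\mathfrak A_0$, $y\in\mathfrak B_0$, extending the multiplication of $\mathfrak A_0\otimes\mathfrak B_0$, and a well-defined involution on $\mathfrak A\otimes\mathfrak B$ with $(a\otimes b)^*=a^*\otimes b^*$ extending the involution of $\mathfrak A_0\otimes\mathfrak B_0$; with these operations $(\mathfrak A\otimes\mathfrak B,\mathfrak A_0\otimes\mathfrak B_0)$ is a quasi *-algebra.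
   Context: All vector spaces are complex. A quasi *-algebra $(\mathfrak A,\mathfrak A_0)$ is a pair consisting of a vector space $\mathfrak A$ and a *-algebra $\mathfrak A_0$ contained in $\mathfrak A$ as a subspace, such that: (i) products $ax$ and $xa$ of $a\in\mathfrak A$ and $x\in\mathfrak A_0$ are always defined (in $\mathfrak A$) and bilinear, extending the multiplication of $\mathfrak A_0$; (ii) $(xa)y=x(ay)$ and $a(xy)=(ax)y$ for all $x,y\in\mathfrak A_0$, $a\in\mathfrak A$; (iii) an involution (conjugate-linear, of period two) is defined on $\mathfrak A$, extending that of $\mathfrak A_0$, with $(ax)^*=x^*a^*$ and $(xa)^*=a^*x^*$ for all $a\in\mathfrak A$, $x\in\mathfrak A_0$. The *-algebra structure of $\mathfrak A_0\otimes\mathfrak B_0$ is determined by $(x\otimes y)(x'\otimes y')=xx'\otimes yy'$ and $(x\otimes y)^*=x^*\otimes y^*$. *)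

theory Defs
  imports Complex_Main "HOL-Library.Poly_Mapping"
begin

section \<open>Complex vector spaces\<close>

class scaleC =
  fixes scaleC :: "complex \<Rightarrow> 'a \<Rightarrow> 'a" (infixr "*\<^sub>C" 75)

class complex_vector = scaleC + ab_group_add +
  assumes scaleC_add_right: "c *\<^sub>C (x + y) = c *\<^sub>C x + c *\<^sub>C y"
    and scaleC_add_left: "(c + d) *\<^sub>C x = c *\<^sub>C x + d *\<^sub>C x"
    and scaleC_scaleC: "c *\<^sub>C d *\<^sub>C x = (c * d) *\<^sub>C x"
    and scaleC_one: "1 *\<^sub>C x = x"

global_interpretation complex_vector:
  vector_space "scaleC :: complex \<Rightarrow> 'a \<Rightarrow> 'a :: complex_vector"
  by unfold_locales (simp_all add: scaleC_add_right scaleC_add_left scaleC_scaleC scaleC_one)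

abbreviation clinear :: "('a::complex_vector \<Rightarrow> 'b::complex_vector) \<Rightarrow> bool" where
  "clinear \<equiv> Vector_Spaces.linear scaleC scaleC"

definition cbilinear ::
    "('a::complex_vector \<Rightarrow> 'b::complex_vector \<Rightarrow> 'c::complex_vector) \<Rightarrow> bool" where
  "cbilinear h \<longleftrightarrow> (\<forall>a. clinear (\<lambda>b. h a b)) \<and> (\<forall>b. clinear (\<lambda>a. h a b))"

definition antilinear :: "('a::complex_vector \<Rightarrow> 'b::complex_vector) \<Rightarrow> bool" where
  "antilinear f \<longleftrightarrow> (\<forall>x y. f (x + y) = f x + f y) \<and> (\<forall>c x. f (c *\<^sub>C x) = cnj c *\<^sub>C f x)"

instantiation complex :: complex_vector
begin

definition scaleC_complex_def: "scaleC a (x::complex) = a * x"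

instance
  by standard (simp_all add: scaleC_complex_def algebra_simps)

end

text \<open>Finitely supported functions; with values in the complex numbers, this is the free vector
  space on the type of the indices.\<close>

instantiation poly_mapping :: (type, complex_vector) complex_vector
begin

lift_definition scaleC_poly_mapping :: "complex \<Rightarrow> ('a \<Rightarrow>\<^sub>0 'b) \<Rightarrow> 'a \<Rightarrow>\<^sub>0 'b"
  is "\<lambda>c f k. c *\<^sub>C f k"
proof -
  fix c and f :: "'a \<Rightarrow> 'b"
  assume "finite {k. f k \<noteq> 0}"
  then show "finite {k. c *\<^sub>C f k \<noteq> 0}"
    by (rule rev_finite_subset) auto
qed

instance
  by standard
    (transfer; simp add: fun_eq_iff scaleC_add_right scaleC_add_left scaleC_scaleC scaleC_one)+

end


section \<open>*-algebras\<close>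

text \<open>Associative, not necessarily unital.\<close>

class star_algebra = complex_vector + ring +
  fixes star :: "'a \<Rightarrow> 'a" ("_\<^sup>\<star>" [1000] 999)
  assumes mult_scaleC_left: "(c *\<^sub>C x) * y = c *\<^sub>C (x * y)"
    and mult_scaleC_right: "x * (c *\<^sub>C y) = c *\<^sub>C (x * y)"
    and star_star: "(x\<^sup>\<star>)\<^sup>\<star> = x"
    and star_add: "(x + y)\<^sup>\<star> = x\<^sup>\<star> + y\<^sup>\<star>"
    and star_scaleC: "(c *\<^sub>C x)\<^sup>\<star> = cnj c *\<^sub>C x\<^sup>\<star>"
    and star_mult: "(x * y)\<^sup>\<star> = y\<^sup>\<star> * x\<^sup>\<star>"


section \<open>Quasi *-algebras\<close>

text \<open>The space is the type \<open>'a\<close> and the *-algebra inside it is the type \<open>'x\<close>, contained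
  in \<open>'a\<close> by means of the injective linear map \<open>incl\<close>. For \<open>a\<close> in the space and \<open>x\<close> in the
  *-algebra, the two partial products \<open>ax\<close> and \<open>xa\<close> are \<open>a \<lhd> x\<close> and \<open>x \<rhd> a\<close>.\<close>

locale quasi_star_algebra =
  fixes incl :: "'x::star_algebra \<Rightarrow> 'a::complex_vector"
    and rmul :: "'a \<Rightarrow> 'x \<Rightarrow> 'a" (infixl "\<lhd>" 70)
    and lmul :: "'x \<Rightarrow> 'a \<Rightarrow> 'a" (infixr "\<rhd>" 70)
    and adj :: "'a \<Rightarrow> 'a"
  assumes incl_linear: "clinear incl"
    and incl_inj: "inj incl"
    and rmul_bilinear: "cbilinear rmul"
    and lmul_bilinear: "cbilinear lmul"
    and rmul_extends: "incl x \<lhd> y = incl (x * y)"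
    and lmul_extends: "x \<rhd> incl y = incl (x * y)"
    and lmul_rmul_assoc: "(x \<rhd> a) \<lhd> y = x \<rhd> (a \<lhd> y)"
    and rmul_mult: "a \<lhd> (x * y) = (a \<lhd> x) \<lhd> y"
    and adj_antilinear: "antilinear adj"
    and adj_adj: "adj (adj a) = a"
    and adj_extends: "adj (incl x) = incl (x\<^sup>\<star>)"
    and adj_rmul: "adj (a \<lhd> x) = x\<^sup>\<star> \<rhd> adj a"
    and adj_lmul: "adj (x \<rhd> a) = adj a \<lhd> x\<^sup>\<star>"


section \<open>The algebraic tensor product\<close>

text \<open>The quotient of the free vector space on \<open>'a \<times> 'b\<close> by the bilinearity relations.\<close>

abbreviation gen :: "'a \<Rightarrow> 'b \<Rightarrow> ('a \<times> 'b) \<Rightarrow>\<^sub>0 complex" where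
  "gen a b \<equiv> Poly_Mapping.single (a, b) 1"

definition tensor_relations :: "(('a::complex_vector \<times> 'b::complex_vector) \<Rightarrow>\<^sub>0 complex) set" where
  "tensor_relations =
     {gen (a + a') b - gen a b - gen a' b | a a' b. True} \<union>
     {gen a (b + b') - gen a b - gen a b' | a b b'. True} \<union>
     {gen (c *\<^sub>C a) b - c *\<^sub>C gen a b | c a b. True} \<union>
     {gen a (c *\<^sub>C b) - c *\<^sub>C gen a b | c a b. True}"

definition tensor_eq ::
    "(('a::complex_vector \<times> 'b::complex_vector) \<Rightarrow>\<^sub>0 complex) \<Rightarrow>
     (('a \<times> 'b) \<Rightarrow>\<^sub>0 complex) \<Rightarrow> bool" where
  "tensor_eq f g \<longleftrightarrow> f - g \<in> complex_vector.span tensor_relations"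

lemma equivp_tensor_eq:
  "equivp (tensor_eq :: (('a::complex_vector \<times> 'b::complex_vector) \<Rightarrow>\<^sub>0 complex) \<Rightarrow> _)" (is "equivp ?R")
proof (rule equivpI)
  show "reflp ?R"
    by (rule reflpI) (simp add: tensor_eq_def complex_vector.span_zero)
  show "symp ?R"
    by (rule sympI) (metis tensor_eq_def complex_vector.span_neg minus_diff_eq)
  show "transp ?R"
  proof (rule transpI)
    fix f g h :: "('a \<times> 'b) \<Rightarrow>\<^sub>0 complex"
    assume "tensor_eq f g" "tensor_eq g h"
    then have "(f - g) + (g - h) \<in> complex_vector.span tensor_relations"
      unfolding tensor_eq_def by (rule complex_vector.span_add)
    then show "tensor_eq f h" by (simp add: tensor_eq_def)
  qed
qed

quotient_type (overloaded) ('a, 'b) tensor =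
    "('a::complex_vector \<times> 'b::complex_vector) \<Rightarrow>\<^sub>0 complex" / tensor_eq
  by (rule equivp_tensor_eq)

instantiation tensor :: (complex_vector, complex_vector) complex_vector
begin

lift_definition zero_tensor :: "('a, 'b) tensor" is 0 .

lift_definition plus_tensor :: "('a, 'b) tensor \<Rightarrow> ('a, 'b) tensor \<Rightarrow> ('a, 'b) tensor"
  is "\<lambda>f g. f + g"
  unfolding tensor_eq_def by (metis add_diff_add complex_vector.span_add)

lift_definition uminus_tensor :: "('a, 'b) tensor \<Rightarrow> ('a, 'b) tensor"
  is "\<lambda>f. - f"
  unfolding tensor_eq_def by (metis minus_diff_minus complex_vector.span_neg)

lift_definition minus_tensor :: "('a, 'b) tensor \<Rightarrow> ('a, 'b) tensor \<Rightarrow> ('a, 'b) tensor"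
  is "\<lambda>f g. f - g"
proof -
  fix f f' g g' :: "('a \<times> 'b) \<Rightarrow>\<^sub>0 complex"
  assume "tensor_eq f f'" "tensor_eq g g'"
  moreover have "f - g - (f' - g') = (f - f') - (g - g')" by simp
  ultimately show "tensor_eq (f - g) (f' - g')"
    unfolding tensor_eq_def by (metis complex_vector.span_diff)
qed

lift_definition scaleC_tensor :: "complex \<Rightarrow> ('a, 'b) tensor \<Rightarrow> ('a, 'b) tensor"
  is "\<lambda>c f. c *\<^sub>C f"
  unfolding tensor_eq_def
  by (metis complex_vector.scale_right_diff_distrib complex_vector.span_scale)

instance
proof
  note refl = equivp_reflp[OF equivp_tensor_eq]
  fix a b c :: "('a, 'b) tensor" and r s :: complex
  show "a + b + c = a + (b + c)" by transfer (simp add: add.assoc refl)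
  show "a + b = b + a" by transfer (simp add: add.commute refl)
  show "0 + a = a" by transfer (simp add: refl)
  show "- a + a = 0" by transfer (simp add: refl)
  show "a - b = a + - b" by transfer (simp add: refl)
  show "r *\<^sub>C (a + b) = r *\<^sub>C a + r *\<^sub>C b" by transfer (simp add: scaleC_add_right refl)
  show "(r + s) *\<^sub>C a = r *\<^sub>C a + s *\<^sub>C a" by transfer (simp add: scaleC_add_left refl)
  show "r *\<^sub>C s *\<^sub>C a = (r * s) *\<^sub>C a" by transfer (simp add: scaleC_scaleC refl)
  show "1 *\<^sub>C a = a" by transfer (simp add: scaleC_one refl)
qed

end

lift_definition tensor :: "'a::complex_vector \<Rightarrow> 'b::complex_vector \<Rightarrow> ('a, 'b) tensor"
    (infixr "\<otimes>" 75)
  is gen .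

lemma tensor_add_left: "(a + a') \<otimes> b = a \<otimes> b + a' \<otimes> b"
  by transfer
    (unfold tensor_eq_def tensor_relations_def diff_diff_eq, rule complex_vector.span_base, blast)

lemma tensor_add_right: "a \<otimes> (b + b') = a \<otimes> b + a \<otimes> b'"
  by transfer
    (unfold tensor_eq_def tensor_relations_def diff_diff_eq, rule complex_vector.span_base, blast)

lemma tensor_scaleC_left: "(c *\<^sub>C a) \<otimes> b = c *\<^sub>C (a \<otimes> b)"
  by transfer (unfold tensor_eq_def tensor_relations_def, rule complex_vector.span_base, blast)

lemma tensor_scaleC_right: "a \<otimes> (c *\<^sub>C b) = c *\<^sub>C (a \<otimes> b)"
  by transfer (unfold tensor_eq_def tensor_relations_def, rule complex_vector.span_base, blast)

lemma clinearI:
  assumes "\<And>x y. f (x + y) = f x + f y" and "\<And>c x. f (c *\<^sub>C x) = c *\<^sub>C f x"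
  shows "clinear f"
  by unfold_locales (use assms in auto)

lemma cbilinear_tensor: "cbilinear (\<otimes>)"
  unfolding cbilinear_def
  by (auto intro!: clinearI
      simp: tensor_add_left tensor_add_right tensor_scaleC_left tensor_scaleC_right)

lemma poly_mapping_expand:
  fixes f :: "'k \<Rightarrow>\<^sub>0 complex"
  shows "f = (\<Sum>p\<in>Poly_Mapping.keys f. Poly_Mapping.lookup f p *\<^sub>C Poly_Mapping.single p 1)"
proof (rule poly_mapping_eqI)
  fix k
  have "Poly_Mapping.lookup (c *\<^sub>C g) k = c * Poly_Mapping.lookup g k"
    for c and g :: "'k \<Rightarrow>\<^sub>0 complex"
    by transfer (simp add: scaleC_complex_def)
  then have "Poly_Mapping.lookup
      (\<Sum>p\<in>Poly_Mapping.keys f. Poly_Mapping.lookup f p *\<^sub>C Poly_Mapping.single p 1) k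
    = (\<Sum>p\<in>Poly_Mapping.keys f. Poly_Mapping.lookup f p * (1 when p = k))"
    by (simp add: lookup_sum lookup_single)
  also have "\<dots> = (\<Sum>p\<in>Poly_Mapping.keys f. if p = k then Poly_Mapping.lookup f p else 0)"
    by (rule sum.cong) (auto simp: when_def)
  also have "\<dots> = Poly_Mapping.lookup f k"
    by (simp add: in_keys_iff)
  finally show "Poly_Mapping.lookup f k = Poly_Mapping.lookup
      (\<Sum>p\<in>Poly_Mapping.keys f. Poly_Mapping.lookup f p *\<^sub>C Poly_Mapping.single p 1) k" ..
qed

lemma tensor_induct [case_names zero add pure]:
  assumes zero: "P 0" and add: "\<And>s t. P s \<Longrightarrow> P t \<Longrightarrow> P (s + t)" and pure: "\<And>a b. P (a \<otimes> b)"
  shows "P t"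
proof -
  obtain f where t: "t = abs_tensor f" by (metis Quotient_abs_rep Quotient_tensor)
  have *: "P (abs_tensor (\<Sum>p\<in>K. c p *\<^sub>C Poly_Mapping.single p 1))" if "finite K" for K c
    using that
  proof (induction K rule: finite_induct)
    case empty
    then show ?case using zero by (simp add: zero_tensor_def)
  next
    case (insert p K)
    obtain a b where p: "p = (a, b)" by (cases p)
    have "abs_tensor (c p *\<^sub>C Poly_Mapping.single p 1) = (c p *\<^sub>C a) \<otimes> b"
      unfolding p tensor_scaleC_left by (simp add: tensor.abs_eq scaleC_tensor.abs_eq)
    then have "P (abs_tensor (c p *\<^sub>C Poly_Mapping.single p 1))" using pure by simp
    with insert show ?case by (simp add: plus_tensor.abs_eq[symmetric] add)
  qed
  show ?thesis unfolding t by (subst poly_mapping_expand) (rule *, simp)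
qed


subsection \<open>Extension of bilinear maps\<close>

text \<open>The scalar multiplication \<open>s\<close> of the target is a parameter so that antilinear extensions
  are covered as well: take \<open>s c = scaleC (cnj c)\<close>. The result is independent of the
  representative only if \<open>h\<close> is bilinear.\<close>

definition tensor_lift ::
    "(complex \<Rightarrow> 'c::ab_group_add \<Rightarrow> 'c) \<Rightarrow> ('a::complex_vector \<Rightarrow> 'b::complex_vector \<Rightarrow> 'c) \<Rightarrow>
     ('a, 'b) tensor \<Rightarrow> 'c" where
  "tensor_lift s h t =
     (\<Sum>p\<in>Poly_Mapping.keys (rep_tensor t).
        s (Poly_Mapping.lookup (rep_tensor t) p) (h (fst p) (snd p)))"

lemma tensor_lift:
  fixes s :: "complex \<Rightarrow> 'c::ab_group_add \<Rightarrow> 'c"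
    and h :: "'a::complex_vector \<Rightarrow> 'b::complex_vector \<Rightarrow> 'c"
  assumes s: "vector_space s"
    and h: "\<And>a. Vector_Spaces.linear scaleC s (\<lambda>b. h a b)"
      "\<And>b. Vector_Spaces.linear scaleC s (\<lambda>a. h a b)"
  shows tensor_lift_linear: "Vector_Spaces.linear scaleC s (tensor_lift s h)"
    and tensor_lift_tensor: "tensor_lift s h (a \<otimes> b) = h a b"
proof -
  interpret V: vector_space s by (rule s)
  define F where "F f = (\<Sum>p\<in>Poly_Mapping.keys f. s (Poly_Mapping.lookup f p) (h (fst p) (snd p)))"
    for f :: "('a \<times> 'b) \<Rightarrow>\<^sub>0 complex"
  have F_eq: "F f = (\<Sum>p\<in>K. s (Poly_Mapping.lookup f p) (h (fst p) (snd p)))"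
    if "finite K" "Poly_Mapping.keys f \<subseteq> K" for f K
    unfolding F_def using that
    by (intro sum.mono_neutral_left) (auto simp: in_keys_iff)
  have F_add: "F (f + g) = F f + F g" for f g
  proof -
    let ?K = "Poly_Mapping.keys f \<union> Poly_Mapping.keys g"
    have "F (f + g) = (\<Sum>p\<in>?K. s (Poly_Mapping.lookup (f + g) p) (h (fst p) (snd p)))"
      by (rule F_eq) (use Poly_Mapping.keys_add[of f g] in auto)
    moreover have "F f = (\<Sum>p\<in>?K. s (Poly_Mapping.lookup f p) (h (fst p) (snd p)))"
      by (rule F_eq) auto
    moreover have "F g = (\<Sum>p\<in>?K. s (Poly_Mapping.lookup g p) (h (fst p) (snd p)))"
      by (rule F_eq) auto
    ultimately show ?thesis
      by (simp add: lookup_add V.scale_left_distrib sum.distrib)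
  qed
  have F_scale: "F (c *\<^sub>C f) = s c (F f)" for c f
  proof -
    have l: "Poly_Mapping.lookup (c *\<^sub>C f) p = c * Poly_Mapping.lookup f p" for p
      by transfer (simp add: scaleC_complex_def)
    have "F (c *\<^sub>C f)
        = (\<Sum>p\<in>Poly_Mapping.keys f. s (Poly_Mapping.lookup (c *\<^sub>C f) p) (h (fst p) (snd p)))"
      by (rule F_eq) (auto simp: in_keys_iff l)
    then show ?thesis
      by (simp add: l F_def V.scale_sum_right)
  qed
  have F_diff: "F (f - g) = F f - F g" for f g
    using F_add[of "f - g" g] by (simp add: algebra_simps)
  have F_gen: "F (gen a b) = h a b" for a b
    by (simp add: F_def)
  have h_add: "h (a + a') b = h a b + h a' b" "h a (b + b') = h a b + h a b'"
    and h_scale: "h (c *\<^sub>C a) b = s c (h a b)" "h a (c *\<^sub>C b) = s c (h a b)" for a a' b b' c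
    using module_hom.add[OF Vector_Spaces.linear.axioms(3)[OF h(1)[of a]]]
      module_hom.scale[OF Vector_Spaces.linear.axioms(3)[OF h(1)[of a]]]
      module_hom.add[OF Vector_Spaces.linear.axioms(3)[OF h(2)[of b]]]
      module_hom.scale[OF Vector_Spaces.linear.axioms(3)[OF h(2)[of b]]]
    by auto
  have F_zero: "F 0 = 0" by (simp add: F_def)
  have F_span: "F r = 0" if "r \<in> complex_vector.span tensor_relations" for r
    using that
  proof (induction rule: complex_vector.span_induct_alt)
    case base
    show ?case by (rule F_zero)
  next
    case (step c x y)
    then have "F x = 0"
      by (auto simp: tensor_relations_def F_diff F_scale F_gen h_add h_scale)
    with step show ?case by (simp add: F_add F_scale)
  qed
  have F_cong: "F f = F g" if "tensor_eq f g" for f g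
    using F_span[of "f - g"] that by (simp add: tensor_eq_def F_diff)
  have lift: "tensor_lift s h (abs_tensor f) = F f" for f
  proof -
    have "tensor_eq (rep_tensor (abs_tensor f)) f"
      using Quotient_tensor equivp_reflp[OF equivp_tensor_eq]
      by (metis Quotient_rep_abs)
    then show ?thesis
      using F_cong by (simp add: tensor_lift_def F_def)
  qed
  show "tensor_lift s h (a \<otimes> b) = h a b"
    by (simp add: tensor.abs_eq lift F_gen)
  have "tensor_lift s h (t + u) = tensor_lift s h t + tensor_lift s h u" for t u
    by (induction t; induction u) (simp add: plus_tensor.abs_eq lift F_add)
  moreover have "tensor_lift s h (c *\<^sub>C t) = s c (tensor_lift s h t)" for c t
    by (induction t) (simp add: scaleC_tensor.abs_eq lift F_scale)
  ultimately show "Vector_Spaces.linear scaleC s (tensor_lift s h)"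
    by unfold_locales auto
qed

definition tensor_map ::
    "('a::complex_vector \<Rightarrow> 'c::complex_vector) \<Rightarrow> ('b::complex_vector \<Rightarrow> 'd::complex_vector) \<Rightarrow>
     ('a, 'b) tensor \<Rightarrow> ('c, 'd) tensor" where
  "tensor_map f g = tensor_lift scaleC (\<lambda>a b. f a \<otimes> g b)"

lemma
  assumes "clinear f" "clinear g"
  shows tensor_map_linear: "clinear (tensor_map f g)"
    and tensor_map_tensor: "tensor_map f g (a \<otimes> b) = f a \<otimes> g b"
proof -
  have *: "clinear (\<lambda>b. f a \<otimes> g b)" "clinear (\<lambda>a. f a \<otimes> g b)" for a b
    using Vector_Spaces.linear.axioms(3)[OF assms(1)] Vector_Spaces.linear.axioms(3)[OF assms(2)]
    by (auto intro!: clinearI simp: module_hom.add module_hom.scale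
        tensor_add_left tensor_add_right tensor_scaleC_left tensor_scaleC_right)
  show "clinear (tensor_map f g)" "tensor_map f g (a \<otimes> b) = f a \<otimes> g b"
    unfolding tensor_map_def
    using tensor_lift_linear[OF complex_vector.vector_space_axioms *]
      tensor_lift_tensor[OF complex_vector.vector_space_axioms *] by auto
qed


text \<open>Elementary tensors span the tensor product, so at most one \<open>M\<close> (respectively \<open>S\<close>)
  satisfies the following predicates; that one exists is the well-definedness of the formula.\<close>

definition is_tensor_bilinear ::
    "('a::complex_vector \<Rightarrow> 'c::complex_vector \<Rightarrow> 'e::complex_vector) \<Rightarrow>
     ('b::complex_vector \<Rightarrow> 'd::complex_vector \<Rightarrow> 'f::complex_vector) \<Rightarrow>
     (('a, 'b) tensor \<Rightarrow> ('c, 'd) tensor \<Rightarrow> ('e, 'f) tensor) \<Rightarrow> bool" where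
  "is_tensor_bilinear f g M \<longleftrightarrow>
     cbilinear M \<and> (\<forall>a b c d. M (a \<otimes> b) (c \<otimes> d) = f a c \<otimes> g b d)"

definition is_tensor_involution ::
    "('a::complex_vector \<Rightarrow> 'a) \<Rightarrow> ('b::complex_vector \<Rightarrow> 'b) \<Rightarrow>
     (('a, 'b) tensor \<Rightarrow> ('a, 'b) tensor) \<Rightarrow> bool" where
  "is_tensor_involution f g S \<longleftrightarrow>
     antilinear S \<and> (\<forall>t. S (S t) = t) \<and> (\<forall>a b. S (a \<otimes> b) = f a \<otimes> g b)"


subsection \<open>The tensor product of *-algebras\<close>

definition tensor_mult ::
    "('a::star_algebra, 'b::star_algebra) tensor \<Rightarrow> ('a, 'b) tensor \<Rightarrow> ('a, 'b) tensor" where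
  "tensor_mult s t =
     tensor_lift scaleC (\<lambda>x y. tensor_lift scaleC (\<lambda>x' y'. (x * x') \<otimes> (y * y')) t) s"

definition tensor_star ::
    "('a::star_algebra, 'b::star_algebra) tensor \<Rightarrow> ('a, 'b) tensor" where
  "tensor_star = tensor_lift (\<lambda>c. scaleC (cnj c)) (\<lambda>x y. x\<^sup>\<star> \<otimes> y\<^sup>\<star>)"

lemma
  fixes s s' t t' :: "('a::star_algebra, 'b::star_algebra) tensor"
    and x x' :: 'a and y y' :: 'b
  shows tensor_mult_add_left: "tensor_mult (s + s') t = tensor_mult s t + tensor_mult s' t"
    and tensor_mult_add_right: "tensor_mult s (t + t') = tensor_mult s t + tensor_mult s t'"
    and tensor_mult_scaleC_left: "tensor_mult (c *\<^sub>C s) t = c *\<^sub>C tensor_mult s t"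
    and tensor_mult_scaleC_right: "tensor_mult s (c *\<^sub>C t) = c *\<^sub>C tensor_mult s t"
    and tensor_mult_tensor: "tensor_mult (x \<otimes> y) (x' \<otimes> y') = (x * x') \<otimes> (y * y')"
proof -
  note C = complex_vector.vector_space_axioms
  note simps = distrib_left distrib_right mult_scaleC_left mult_scaleC_right
    tensor_add_left tensor_add_right tensor_scaleC_left tensor_scaleC_right
  define G :: "'a \<Rightarrow> 'b \<Rightarrow> ('a, 'b) tensor \<Rightarrow> ('a, 'b) tensor"
    where "G x y = tensor_lift scaleC (\<lambda>x' y'. (x * x') \<otimes> (y * y'))" for x y
  have h: "clinear (\<lambda>y'. (x * x') \<otimes> (y * y'))" "clinear (\<lambda>x'. (x * x') \<otimes> (y * y'))"
    for x x' :: 'a and y y' :: 'b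
    by (auto intro!: clinearI simp: simps)
  have G: "module_hom scaleC scaleC (G x y)" for x y
    unfolding G_def by (rule Vector_Spaces.linear.axioms(3)[OF tensor_lift_linear[OF C h]])
  note Gs = module_hom.add[OF G] module_hom.scale[OF G] module_hom.zero[OF G]
  have G_tensor: "G x y (x' \<otimes> y') = (x * x') \<otimes> (y * y')" for x y x' y'
    unfolding G_def by (rule tensor_lift_tensor[OF C h])
  have G_add1: "G (x1 + x2) y u = G x1 y u + G x2 y u" for x1 x2 y u
    by (induction u rule: tensor_induct) (simp_all add: Gs G_tensor simps)
  have G_add2: "G x (y1 + y2) u = G x y1 u + G x y2 u" for x y1 y2 u
    by (induction u rule: tensor_induct) (simp_all add: Gs G_tensor simps)
  have G_sc1: "G (c *\<^sub>C x) y u = c *\<^sub>C G x y u" for c x y u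
    by (induction u rule: tensor_induct) (simp_all add: Gs G_tensor simps scaleC_add_right)
  have G_sc2: "G x (c *\<^sub>C y) u = c *\<^sub>C G x y u" for c x y u
    by (induction u rule: tensor_induct) (simp_all add: Gs G_tensor simps scaleC_add_right)
  have k: "clinear (\<lambda>y. G x y u)" "clinear (\<lambda>x. G x y u)" for x y u
    by (auto intro!: clinearI simp: G_add1 G_add2 G_sc1 G_sc2)
  have M_def: "tensor_mult s t = tensor_lift scaleC (\<lambda>x y. G x y t) s" for s t
    by (simp add: tensor_mult_def G_def)
  have M: "module_hom scaleC scaleC (\<lambda>s. tensor_mult s t)" for t :: "('a, 'b) tensor"
    using Vector_Spaces.linear.axioms(3)[OF tensor_lift_linear[OF C k]]
    unfolding M_def .
  note Ms = module_hom.add[OF M] module_hom.scale[OF M] module_hom.zero[OF M]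
  have M_tensor: "tensor_mult (x \<otimes> y) t = G x y t" for x y t
    unfolding M_def by (rule tensor_lift_tensor[OF C k])
  show "tensor_mult (s + s') t = tensor_mult s t + tensor_mult s' t"
    and "tensor_mult (c *\<^sub>C s) t = c *\<^sub>C tensor_mult s t"
    by (fact Ms)+
  show "tensor_mult (x \<otimes> y) (x' \<otimes> y') = (x * x') \<otimes> (y * y')"
    by (simp add: M_tensor G_tensor)
  show "tensor_mult s (t + t') = tensor_mult s t + tensor_mult s t'"
    by (induction s rule: tensor_induct) (simp_all add: Ms M_tensor Gs)
  show "tensor_mult s (c *\<^sub>C t) = c *\<^sub>C tensor_mult s t"
    by (induction s rule: tensor_induct) (simp_all add: Ms M_tensor Gs scaleC_add_right)
qed

lemma
  fixes s t :: "('a::star_algebra, 'b::star_algebra) tensor" and x :: 'a and y :: 'b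
  shows tensor_star_add: "tensor_star (s + t) = tensor_star s + tensor_star t"
    and tensor_star_scaleC: "tensor_star (c *\<^sub>C s) = cnj c *\<^sub>C tensor_star s"
    and tensor_star_tensor: "tensor_star (x \<otimes> y) = x\<^sup>\<star> \<otimes> y\<^sup>\<star>"
proof -
  have C: "vector_space (\<lambda>c. scaleC (cnj c) :: ('a, 'b) tensor \<Rightarrow> _)"
    by unfold_locales (simp_all add: scaleC_add_right scaleC_add_left scaleC_scaleC scaleC_one)
  interpret C: vector_space "\<lambda>c. scaleC (cnj c) :: ('a, 'b) tensor \<Rightarrow> _" by (rule C)
  have h: "Vector_Spaces.linear scaleC (\<lambda>c. scaleC (cnj c)) (\<lambda>y. x\<^sup>\<star> \<otimes> y\<^sup>\<star>)"
    "Vector_Spaces.linear scaleC (\<lambda>c. scaleC (cnj c)) (\<lambda>x. x\<^sup>\<star> \<otimes> y\<^sup>\<star>)"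
    for x :: 'a and y :: 'b
    by - (unfold_locales; simp add: star_add star_scaleC scaleC_add_left scaleC_add_right
        tensor_add_left tensor_add_right tensor_scaleC_left tensor_scaleC_right)+
  note m = Vector_Spaces.linear.axioms(3)[OF tensor_lift_linear[OF C h]]
  show "tensor_star (s + t) = tensor_star s + tensor_star t"
    and "tensor_star (c *\<^sub>C s) = cnj c *\<^sub>C tensor_star s"
    unfolding tensor_star_def by (rule module_hom.add[OF m], rule module_hom.scale[OF m])
  show "tensor_star (x \<otimes> y) = x\<^sup>\<star> \<otimes> y\<^sup>\<star>"
    unfolding tensor_star_def by (rule tensor_lift_tensor[OF C h])
qed

instantiation tensor :: (star_algebra, star_algebra) star_algebra
begin

definition times_tensor_def: "(s :: ('a, 'b) tensor) * t = tensor_mult s t"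

definition star_tensor_def: "star (t :: ('a, 'b) tensor) = tensor_star t"

instance
proof
  note add = tensor_mult_add_left tensor_mult_add_right tensor_star_add
  have zero: "tensor_mult 0 u = 0" "tensor_mult u 0 = 0" "tensor_star (0 :: ('a, 'b) tensor) = 0"
    for u :: "('a, 'b) tensor"
    using tensor_mult_add_left[of 0 0 u] tensor_mult_add_right[of u 0 0]
      tensor_star_scaleC[of 0 "0 :: ('a, 'b) tensor"] by simp_all
  note tens = tensor_mult_tensor tensor_star_tensor
  fix a b c :: "('a, 'b) tensor" and r :: complex
  have 1: "tensor_mult (tensor_mult (x \<otimes> y) (x' \<otimes> y')) c
      = tensor_mult (x \<otimes> y) (tensor_mult (x' \<otimes> y') c)" for x x' y y'
    by (induction c rule: tensor_induct) (simp_all add: add zero tens mult.assoc)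
  have 2: "tensor_mult (tensor_mult (x \<otimes> y) b) c = tensor_mult (x \<otimes> y) (tensor_mult b c)" for x y
    by (induction b rule: tensor_induct) (simp_all add: add zero 1)
  have "tensor_mult (tensor_mult a b) c = tensor_mult a (tensor_mult b c)"
    by (induction a rule: tensor_induct) (simp_all add: add zero 2)
  then show "a * b * c = a * (b * c)" by (simp add: times_tensor_def)
  show "(a + b) * c = a * c + b * c" "a * (b + c) = a * b + a * c"
    by (simp_all add: times_tensor_def add)
  show "(r *\<^sub>C a) * b = r *\<^sub>C (a * b)" "a * (r *\<^sub>C b) = r *\<^sub>C (a * b)"
    by (simp_all add: times_tensor_def tensor_mult_scaleC_left tensor_mult_scaleC_right)
  show "star (star a) = a"
    unfolding star_tensor_def
    by (induction a rule: tensor_induct) (simp_all add: add zero tens star_star)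
  show "star (a + b) = star a + star b" by (simp add: star_tensor_def add)
  show "star (r *\<^sub>C a) = cnj r *\<^sub>C star a" by (simp add: star_tensor_def tensor_star_scaleC)
  have 3: "tensor_star (tensor_mult (x \<otimes> y) b) = tensor_mult (tensor_star b) (tensor_star (x \<otimes> y))"
    for x y
    by (induction b rule: tensor_induct) (simp_all add: add zero tens star_mult)
  show "star (a * b) = star b * star a"
    unfolding star_tensor_def times_tensor_def
    by (induction a rule: tensor_induct) (simp_all add: add zero 3)
qed

end

lemma tensor_times_tensor:
  fixes x x' :: "'a::star_algebra" and y y' :: "'b::star_algebra"
  shows "(x \<otimes> y) * (x' \<otimes> y') = (x * x') \<otimes> (y * y')"
  by (simp add: times_tensor_def tensor_mult_tensor)

lemma star_tensor:
  fixes x :: "'a::star_algebra" and y :: "'b::star_algebra"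
  shows "(x \<otimes> y)\<^sup>\<star> = x\<^sup>\<star> \<otimes> y\<^sup>\<star>"
  by (simp add: star_tensor_def tensor_star_tensor)

end

(* A quasi *-algebra structure on the tensor product is built by the universal property:
   the partial products are obtained by lifting a bilinear family of tensor products of linear
   maps, and the algebraic identities are additive in each argument, so that it suffices to
   check them on elementary tensors.  The only point that is not formal is that incl is
   injective: over a field the two given inclusions have linear left inverses, and the tensor
   product of these is a left inverse of incl. *)

theory Submission
  imports Defs
begin

section \<open>Rules for linear, bilinear and antilinear maps\<close>

lemma clinear_add: "clinear f \<Longrightarrow> f (x + y) = f x + f y"
  and clinear_scaleC: "clinear f \<Longrightarrow> f (c *\<^sub>C x) = c *\<^sub>C f x"
  and clinear_zero: "clinear f \<Longrightarrow> f 0 = 0"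
  by (auto dest!: Vector_Spaces.linear.axioms(3) simp: module_hom.add module_hom.scale module_hom.zero)

lemma
  assumes "cbilinear h"
  shows cbilinear_clinear_right: "clinear (h a)"
    and cbilinear_add_left: "h (a + a') b = h a b + h a' b"
    and cbilinear_add_right: "h a (b + b') = h a b + h a b'"
    and cbilinear_scaleC_left: "h (c *\<^sub>C a) b = c *\<^sub>C h a b"
    and cbilinear_scaleC_right: "h a (c *\<^sub>C b) = c *\<^sub>C h a b"
    and cbilinear_zero_left: "h 0 b = 0"
    and cbilinear_zero_right: "h a 0 = 0"
proof -
  have r: "clinear (h a)" for a
    using assms by (simp add: cbilinear_def)
  have l: "clinear (\<lambda>a. h a b)" for b
    using assms by (simp add: cbilinear_def)
  show "clinear (h a)" by (rule r)
  show "h (a + a') b = h a b + h a' b" "h (c *\<^sub>C a) b = c *\<^sub>C h a b" "h 0 b = 0"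
    using clinear_add[OF l] clinear_scaleC[OF l] clinear_zero[OF l] by auto
  show "h a (b + b') = h a b + h a b'" "h a (c *\<^sub>C b) = c *\<^sub>C h a b" "h a 0 = 0"
    using clinear_add[OF r] clinear_scaleC[OF r] clinear_zero[OF r] by auto
qed

lemmas cbilinear_simps = cbilinear_add_left cbilinear_add_right cbilinear_scaleC_left
  cbilinear_scaleC_right cbilinear_zero_left cbilinear_zero_right

lemma cbilinearI:
  assumes "\<And>a a' b. h (a + a') b = h a b + h a' b" "\<And>a b b'. h a (b + b') = h a b + h a b'"
    and "\<And>c a b. h (c *\<^sub>C a) b = c *\<^sub>C h a b" "\<And>c a b. h a (c *\<^sub>C b) = c *\<^sub>C h a b"
  shows "cbilinear h"
  unfolding cbilinear_def by (auto intro!: clinearI simp: assms)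

text \<open>This puts the product of the tensor product algebra under the same rules
  \<open>cbilinear_simps\<close> as the partial products.\<close>

lemma cbilinear_mult: "cbilinear ((*) :: 'a::star_algebra \<Rightarrow> 'a \<Rightarrow> 'a)"
  by (rule cbilinearI) (simp_all add: algebra_simps mult_scaleC_left mult_scaleC_right)

lemma antilinear_add: "antilinear f \<Longrightarrow> f (x + y) = f x + f y"
  and antilinear_scaleC: "antilinear f \<Longrightarrow> f (c *\<^sub>C x) = cnj c *\<^sub>C f x"
  by (auto simp: antilinear_def)

lemma antilinear_zero: "antilinear f \<Longrightarrow> f 0 = 0"
  using antilinear_add[of f 0 0] by simp

lemmas tensor_simps = tensor_add_left tensor_add_right tensor_scaleC_left tensor_scaleC_right

section \<open>Injectivity of tensor products of linear maps\<close>

lemma tensor_map_left_inverse: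
  assumes "clinear f" "clinear g" "clinear f'" "clinear g'"
    and "\<And>a. f' (f a) = a" "\<And>b. g' (g b) = b"
  shows "tensor_map f' g' (tensor_map f g t) = t"
  by (induction t rule: tensor_induct)
    (simp_all add: assms tensor_map_tensor tensor_map_linear clinear_add clinear_zero)

text \<open>An injective linear map sends a basis to an independent set. Extend that set to a basis
  of the target, undo \<open>f\<close> on it, and choose the values on the remaining basis vectors
  freely.\<close>

lemma inj_clinear_left_inverse:
  assumes "clinear f" "inj f"
  obtains g where "clinear g" "\<And>x. g (f x) = x"
proof -
  interpret vector_space_pair "scaleC :: complex \<Rightarrow> 'a \<Rightarrow> 'a" "scaleC :: complex \<Rightarrow> 'b \<Rightarrow> 'b" ..
  show thesis
    using linear_injective_left_inverse[OF assms] that by (auto simp: fun_eq_iff)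
qed

text \<open>This depends on the scalars forming a field: over a general ring, tensoring can destroy
  injectivity.\<close>

lemma inj_tensor_map:
  assumes "clinear f" "clinear g" "inj f" "inj g"
  shows "inj (tensor_map f g)"
proof -
  obtain f' g' where "clinear f'" "\<And>a. f' (f a) = a" "clinear g'" "\<And>b. g' (g b) = b"
    using inj_clinear_left_inverse[OF assms(1,3)] inj_clinear_left_inverse[OF assms(2,4)] by metis
  then show ?thesis
    using tensor_map_left_inverse[OF assms(1,2)] by (metis injI)
qed

section \<open>Existence and uniqueness of the operations\<close>

lemma is_tensor_bilinear_exists:
  fixes f :: "'a::complex_vector \<Rightarrow> 'c::complex_vector \<Rightarrow> 'e::complex_vector"
    and g :: "'b::complex_vector \<Rightarrow> 'd::complex_vector \<Rightarrow> 'f::complex_vector"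
  assumes f: "cbilinear f" and g: "cbilinear g"
  shows "\<exists>M. is_tensor_bilinear f g M"
proof -
  \<comment> \<open>The universal property is applied once per argument. \<open>G a b\<close> is the
    operator by which \<open>a \<otimes> b\<close> is to act on the second argument;
    \<open>M\<close> below lifts \<open>G\<close> in the first.\<close>
  define G where "G a b = tensor_map (f a) (g b)" for a b
  note lin = cbilinear_clinear_right[OF f] cbilinear_clinear_right[OF g]
  have G_linear: "clinear (G a b)" for a b
    unfolding G_def by (rule tensor_map_linear[OF lin])
  note G_simps = clinear_add[OF G_linear] clinear_scaleC[OF G_linear] clinear_zero[OF G_linear]
  have G_tensor: "G a b (c \<otimes> d) = f a c \<otimes> g b d" for a b c d
    unfolding G_def by (rule tensor_map_tensor[OF lin])
  note simps = G_simps G_tensor cbilinear_simps[OF f] cbilinear_simps[OF g] tensor_simps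
  \<comment> \<open>Lifting \<open>G\<close> requires bilinearity in \<open>a\<close> and
    \<open>b\<close>. With \<open>t\<close> fixed this is an equation between additive functions of
    \<open>t\<close>, so elementary tensors suffice.\<close>
  have G_add: "G (a + a') b t = G a b t + G a' b t" "G a (b + b') t = G a b t + G a b' t"
    for a a' b b' t
    by (induction t rule: tensor_induct; simp add: simps)+
  have G_scaleC: "G (c *\<^sub>C a) b t = c *\<^sub>C G a b t" "G a (c *\<^sub>C b) t = c *\<^sub>C G a b t" for c a b t
    by (induction t rule: tensor_induct; simp add: simps scaleC_add_right)+
  have h: "clinear (\<lambda>b. G a b t)" "clinear (\<lambda>a. G a b t)" for a b t
    by (auto intro!: clinearI simp: G_add G_scaleC)
  define M where "M s t = tensor_lift scaleC (\<lambda>a b. G a b t) s" for s t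
  have M_linear: "clinear (\<lambda>s. M s t)" for t
    unfolding M_def by (rule tensor_lift_linear[OF complex_vector.vector_space_axioms h])
  have M_tensor: "M (a \<otimes> b) t = G a b t" for a b t
    unfolding M_def by (rule tensor_lift_tensor[OF complex_vector.vector_space_axioms h])
  note M_simps = clinear_add[OF M_linear] clinear_scaleC[OF M_linear] clinear_zero[OF M_linear]
  \<comment> \<open>The lift gives linearity in \<open>s\<close> only. Linearity in \<open>t\<close>
    is inherited from \<open>G\<close>, to which \<open>M\<close> reduces when \<open>s\<close> is
    elementary.\<close>
  have "M s (t + t') = M s t + M s t'" for s t t'
    by (induction s rule: tensor_induct) (simp_all add: M_simps M_tensor G_simps)
  moreover have "M s (c *\<^sub>C t) = c *\<^sub>C M s t" for c s t
    by (induction s rule: tensor_induct) (simp_all add: M_simps M_tensor G_simps scaleC_add_right)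
  ultimately have "cbilinear M"
    by (intro cbilinearI) (simp_all add: M_simps)
  then have "is_tensor_bilinear f g M"
    by (simp add: is_tensor_bilinear_def M_tensor G_tensor)
  then show ?thesis
    by blast
qed

lemma is_tensor_bilinear_unique:
  assumes "is_tensor_bilinear f g M" "is_tensor_bilinear f g N"
  shows "M = N"
proof (intro ext)
  fix s t
  have M: "cbilinear M" "\<And>a b c d. M (a \<otimes> b) (c \<otimes> d) = f a c \<otimes> g b d"
    and N: "cbilinear N" "\<And>a b c d. N (a \<otimes> b) (c \<otimes> d) = f a c \<otimes> g b d"
    using assms by (auto simp: is_tensor_bilinear_def)
  note simps = cbilinear_simps[OF M(1)] cbilinear_simps[OF N(1)] M(2) N(2)
  \<comment> \<open>The arguments are freed one at a time: first \<open>t\<close> with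
    \<open>s\<close> elementary, then \<open>s\<close>.\<close>
  have "M (a \<otimes> b) t = N (a \<otimes> b) t" for a b
    by (induction t rule: tensor_induct) (simp_all add: simps)
  then show "M s t = N s t"
    by (induction s rule: tensor_induct) (simp_all add: simps)
qed

text \<open>An antilinear map is linear for the conjugated scalar action \<open>?s\<close> on its
  target, so the universal property yields antilinear maps too.\<close>

lemma is_tensor_involution_exists:
  fixes f :: "'a::complex_vector \<Rightarrow> 'a" and g :: "'b::complex_vector \<Rightarrow> 'b"
  assumes f: "antilinear f" "\<And>a. f (f a) = a" and g: "antilinear g" "\<And>b. g (g b) = b"
  shows "\<exists>S. is_tensor_involution f g S"
proof -
  let ?s = "\<lambda>c. scaleC (cnj c) :: ('a, 'b) tensor \<Rightarrow> _"
  have C: "vector_space ?s"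
    by unfold_locales (simp_all add: scaleC_add_right scaleC_add_left scaleC_scaleC scaleC_one)
  interpret C: vector_space ?s by (rule C)
  note simps = antilinear_add[OF f(1)] antilinear_scaleC[OF f(1)]
    antilinear_add[OF g(1)] antilinear_scaleC[OF g(1)] tensor_simps
  have h: "Vector_Spaces.linear scaleC ?s (\<lambda>b. f a \<otimes> g b)"
    "Vector_Spaces.linear scaleC ?s (\<lambda>a. f a \<otimes> g b)" for a b
    by - (unfold_locales; simp add: simps scaleC_add_left scaleC_add_right)+
  define S where "S = tensor_lift ?s (\<lambda>a b. f a \<otimes> g b)"
  note m = Vector_Spaces.linear.axioms(3)[OF tensor_lift_linear[OF C h], folded S_def]
  have S: "antilinear S"
    unfolding antilinear_def by (simp add: module_hom.add[OF m] module_hom.scale[OF m])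
  have S_tensor: "S (a \<otimes> b) = f a \<otimes> g b" for a b
    unfolding S_def by (rule tensor_lift_tensor[OF C h])
  \<comment> \<open>The composite of \<open>S\<close> with itself is additive and fixes every
    elementary tensor, because \<open>f\<close> and \<open>g\<close> have period two.\<close>
  have "S (S t) = t" for t
    by (induction t rule: tensor_induct)
      (simp_all add: antilinear_add[OF S] antilinear_zero[OF S] S_tensor f(2) g(2))
  with S S_tensor show ?thesis
    by (auto simp: is_tensor_involution_def)
qed

lemma is_tensor_involution_unique:
  assumes "is_tensor_involution f g S" "is_tensor_involution f g T"
  shows "S = T"
proof
  fix t
  have S: "antilinear S" "\<And>a b. S (a \<otimes> b) = f a \<otimes> g b"
    and T: "antilinear T" "\<And>a b. T (a \<otimes> b) = f a \<otimes> g b"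
    using assms by (auto simp: is_tensor_involution_def)
  show "S t = T t"
    by (induction t rule: tensor_induct)
      (simp_all add: antilinear_add[OF S(1)] antilinear_zero[OF S(1)] S(2)
        antilinear_add[OF T(1)] antilinear_zero[OF T(1)] T(2))
qed

section \<open>The quasi *-algebra axioms on the tensor product\<close>

lemma quasi_star_algebra_tensor:
  fixes inclA :: "'x::star_algebra \<Rightarrow> 'a::complex_vector"
    and inclB :: "'y::star_algebra \<Rightarrow> 'b::complex_vector"
  assumes "quasi_star_algebra inclA rmulA lmulA adjA"
    and "quasi_star_algebra inclB rmulB lmulB adjB"
    and "is_tensor_bilinear rmulA rmulB R" "is_tensor_bilinear lmulA lmulB L"
    and "is_tensor_involution adjA adjB S"
  shows "quasi_star_algebra (tensor_map inclA inclB) R L S"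
proof -
  interpret A: quasi_star_algebra inclA rmulA lmulA adjA by fact
  interpret B: quasi_star_algebra inclB rmulB lmulB adjB by fact
  let ?incl = "tensor_map inclA inclB"
  \<comment> \<open>The operations enter through these properties alone, so the argument covers all
    \<open>R\<close>, \<open>L\<close>, \<open>S\<close> that have them.\<close>
  have R: "cbilinear R" "\<And>a b x y. R (a \<otimes> b) (x \<otimes> y) = rmulA a x \<otimes> rmulB b y"
    and L: "cbilinear L" "\<And>x y a b. L (x \<otimes> y) (a \<otimes> b) = lmulA x a \<otimes> lmulB y b"
    and S: "antilinear S" "\<And>t. S (S t) = t" "\<And>a b. S (a \<otimes> b) = adjA a \<otimes> adjB b"
    using assms(3-5) by (auto simp: is_tensor_bilinear_def is_tensor_involution_def)
  have I: "clinear ?incl"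
    by (rule tensor_map_linear[OF A.incl_linear B.incl_linear])
  note simps = clinear_add[OF I] clinear_zero[OF I]
    tensor_map_tensor[OF A.incl_linear B.incl_linear]
    cbilinear_simps[OF R(1)] R(2) cbilinear_simps[OF L(1)] L(2)
    antilinear_add[OF S(1)] antilinear_zero[OF S(1)] S(3)
    cbilinear_simps[OF cbilinear_mult] tensor_times_tensor
    star_add star_tensor
  \<comment> \<open>This serves the zero case of the inductions over tensors that involve the
    star.\<close>
  have star_zero: "0\<^sup>\<star> = (0 :: ('x, 'y) tensor)"
    using star_add[of "0 :: ('x, 'y) tensor" 0] by simp
  note simps = simps star_zero
  \<comment> \<open>Each identity from here on is additive in every variable. Nested inductions
    reduce it to elementary tensors, where it is the corresponding axiom in both factors. Scalars
    need no separate case, since a multiple of an elementary tensor is elementary.\<close>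
  have R_incl: "R (?incl s) t = ?incl (s * t)" for s t
  proof (induction s rule: tensor_induct)
    case (pure x y)
    show ?case
      by (induction t rule: tensor_induct) (simp_all add: simps A.rmul_extends B.rmul_extends)
  qed (simp_all add: simps)
  have L_incl: "L s (?incl t) = ?incl (s * t)" for s t
  proof (induction s rule: tensor_induct)
    case (pure x y)
    show ?case
      by (induction t rule: tensor_induct) (simp_all add: simps A.lmul_extends B.lmul_extends)
  qed (simp_all add: simps)
  have assoc: "R (L s u) t = L s (R u t)" for s u t
  proof (induction s rule: tensor_induct)
    case (pure x y)
    show ?case
    proof (induction u rule: tensor_induct)
      case (pure a b)
      show ?case
        by (induction t rule: tensor_induct) (simp_all add: simps A.lmul_rmul_assoc B.lmul_rmul_assoc)
    qed (simp_all add: simps)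
  qed (simp_all add: simps)
  have R_mult: "R u (s * t) = R (R u s) t" for u s t
  proof (induction u rule: tensor_induct)
    case (pure a b)
    show ?case
    proof (induction s rule: tensor_induct)
      case (pure x y)
      show ?case
        by (induction t rule: tensor_induct) (simp_all add: simps A.rmul_mult B.rmul_mult)
    qed (simp_all add: simps)
  qed (simp_all add: simps)
  have S_incl: "S (?incl t) = ?incl (t\<^sup>\<star>)" for t
    by (induction t rule: tensor_induct) (simp_all add: simps A.adj_extends B.adj_extends)
  \<comment> \<open>On elementary tensors the two given involutions exchange right and left products
    in both factors at once.\<close>
  have S_R: "S (R u t) = L (t\<^sup>\<star>) (S u)" for u t
  proof (induction u rule: tensor_induct)
    case (pure a b)
    show ?case
      by (induction t rule: tensor_induct) (simp_all add: simps A.adj_rmul B.adj_rmul)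
  qed (simp_all add: simps)
  have S_L: "S (L t u) = R (S u) (t\<^sup>\<star>)" for u t
  proof (induction u rule: tensor_induct)
    case (pure a b)
    show ?case
      by (induction t rule: tensor_induct) (simp_all add: simps A.adj_lmul B.adj_lmul)
  qed (simp_all add: simps)
  show ?thesis
    by (rule quasi_star_algebra.intro)
      (fact I inj_tensor_map[OF A.incl_linear B.incl_linear A.incl_inj B.incl_inj]
        R(1) L(1) R_incl L_incl assoc R_mult S(1) S(2) S_incl S_R S_L)+
qed

theorem mainTheorem1:
  fixes inclA :: "'x::star_algebra \<Rightarrow> 'a::complex_vector"
    and rmulA :: "'a \<Rightarrow> 'x \<Rightarrow> 'a" and lmulA :: "'x \<Rightarrow> 'a \<Rightarrow> 'a" and adjA :: "'a \<Rightarrow> 'a"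
    and inclB :: "'y::star_algebra \<Rightarrow> 'b::complex_vector"
    and rmulB :: "'b \<Rightarrow> 'y \<Rightarrow> 'b" and lmulB :: "'y \<Rightarrow> 'b \<Rightarrow> 'b" and adjB :: "'b \<Rightarrow> 'b"
  assumes "quasi_star_algebra inclA rmulA lmulA adjA"
    and "quasi_star_algebra inclB rmulB lmulB adjB"
  shows "let incl = tensor_map inclA inclB in
    clinear incl \<and> inj incl \<and> (\<forall>x y. incl (x \<otimes> y) = inclA x \<otimes> inclB y) \<and>
    (\<exists>!R. is_tensor_bilinear rmulA rmulB R) \<and>
    (\<exists>!L. is_tensor_bilinear lmulA lmulB L) \<and>
    (\<exists>!S. is_tensor_involution adjA adjB S) \<and>
    (\<forall>R L S. is_tensor_bilinear rmulA rmulB R \<and> is_tensor_bilinear lmulA lmulB L \<and>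
        is_tensor_involution adjA adjB S \<longrightarrow>
      (\<forall>s t. R (incl s) t = incl (s * t)) \<and>
      (\<forall>s t. L s (incl t) = incl (s * t)) \<and>
      (\<forall>t. S (incl t) = incl (t\<^sup>\<star>)) \<and>
      quasi_star_algebra incl R L S)"
proof -
  interpret A: quasi_star_algebra inclA rmulA lmulA adjA by fact
  interpret B: quasi_star_algebra inclB rmulB lmulB adjB by fact
  let ?incl = "tensor_map inclA inclB"
  have "clinear ?incl" "inj ?incl" "\<forall>x y. ?incl (x \<otimes> y) = inclA x \<otimes> inclB y"
    using A.incl_linear B.incl_linear A.incl_inj B.incl_inj
    by (simp_all add: tensor_map_linear inj_tensor_map tensor_map_tensor)
  moreover have "\<exists>!R. is_tensor_bilinear rmulA rmulB R"
    using is_tensor_bilinear_exists[OF A.rmul_bilinear B.rmul_bilinear]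
    by (auto intro: is_tensor_bilinear_unique)
  moreover have "\<exists>!L. is_tensor_bilinear lmulA lmulB L"
    using is_tensor_bilinear_exists[OF A.lmul_bilinear B.lmul_bilinear]
    by (auto intro: is_tensor_bilinear_unique)
  moreover have "\<exists>!S. is_tensor_involution adjA adjB S"
    using is_tensor_involution_exists[OF A.adj_antilinear A.adj_adj B.adj_antilinear B.adj_adj]
    by (auto intro: is_tensor_involution_unique)
  \<comment> \<open>The three extension properties are themselves axioms of the structure, so they
    are read off from it.\<close>
  moreover have "(\<forall>s t. R (?incl s) t = ?incl (s * t)) \<and> (\<forall>s t. L s (?incl t) = ?incl (s * t)) \<and>
      (\<forall>t. S (?incl t) = ?incl (t\<^sup>\<star>)) \<and> quasi_star_algebra ?incl R L S"
    if "is_tensor_bilinear rmulA rmulB R" "is_tensor_bilinear lmulA lmulB L"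
      "is_tensor_involution adjA adjB S" for R L S
  proof -
    interpret Q: quasi_star_algebra ?incl R L S
      by (rule quasi_star_algebra_tensor[OF assms that])
    show ?thesis
      using Q.rmul_extends Q.lmul_extends Q.adj_extends Q.quasi_star_algebra_axioms by blast
  qed
  ultimately show ?thesis
    unfolding Let_def by blast
qed

end
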